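(* Let $\mathbb{F}$ be a finite field, let $s,\ell\ge 1$ be integers, and let $I$ be an ideal of $R=\mathbb{F}[x,y]/\langle x^s-1,\,y^{\ell}-1\rangle$. For $j=0,\dots,\ell-1$ let $I_j$ be the $j$-th coefficient ideal of $I$ in $S=\mathbb{F}[x]/\langle x^s-1\rangle$, let $p_j^j(x)$ be its monic generator dividing $x^s-1$, and let $\mathfrak{p}_j(x,y)\in I$ be an element of the form $\mathfrak{p}_j(x,y)=\sum_{i=j}^{\ell-1}p_i^j(x)y^i$ with $p_i^j(x)\in S$ whose coefficient of $y^j$ is $p_j^j(x)$ (all as defined in the context). Then $$I=\langle \mathfrak{p}_0(x,y),\dots,\mathfrak{p}_{\ell-1}(x,y)\rangle ,$$ and for each $j=0,\dots,\ell-1$ there are elements $t_i^j(x)\in S$ ($j\le i\le \ell-1$) such that $\mathfrak{p}_j(x,y)=\sum_{i=j}^{\ell-1}p_0^0(x)\,t_i^j(x)\,y^i$.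
   Context: Write $S=\mathbb{F}[x]/\langle x^s-1\rangle$ and $R=\mathbb{F}[x,y]/\langle x^s-1,y^\ell-1\rangle\cong S[y]/\langle y^\ell-1\rangle$. Cosets are denoted by their representatives. Every element of $R$ can be written uniquely as $\sum_{i=0}^{\ell-1}f_i(x)y^i$ with $f_i(x)\in S$. For an ideal $I$ of $R$ and $0\le j\le \ell-1$, the $j$-th coefficient ideal is $$I_j=\Big\{g_j(x)\in S:\ \text{there exists } g(x,y)\in I \text{ such that } g(x,y)=\sum_{i=j}^{\ell-1}g_i(x)y^i \text{ with } g_i(x)\in S\Big\}.$$ Each $I_j$ is an ideal of the principal ideal ring $S$, and $p_j^j(x)\in\mathbb{F}[x]$ denotes the unique monic divisor of $x^s-1$ in $\mathbb{F}[x]$ such that $I_j=\langle p_j^j(x)\rangle$ in $S$ (so $p_j^j(x)=x^s-1$ when $I_j=0$). Since $p_j^j(x)\in I_j$, there exists an element $\mathfrak{p}_j(x,y)\in I$ of the form $\mathfrak{p}_j(x,y)=\sum_{i=j}^{\ell-1}p_i^j(x)y^i$, with $p_i^j(x)\in S$ and with coefficient of $y^j$ equal to (the class of) $p_j^j(x)$; one such element is fixed for each $j$. Ideals of $R$ correspond to two-dimensional cyclic codes of length $s\ell$ over $\mathbb{F}$. *)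

theory Defs
  imports "HOL-Algebra.Algebraic_Closure_Type"
begin

text \<open>
  The finite field is the type \<open>'a :: {field, finite}\<close>.  The ring F[x] is the type
  \<open>'a poly\<close>, and F[x,y] = F[x][y] is \<open>'a poly poly\<close>: the outer variable is y and
  the inner variable is x.  Both are turned into HOL-Algebra rings by
  \<open>ring_of_type_algebra\<close>; elements of the quotients S and R are cosets.
\<close>

definition x_relation :: "nat \<Rightarrow> 'a::field poly" where
  "x_relation s = Polynomial.monom 1 s - 1"

definition S_modulus :: "nat \<Rightarrow> 'a::field poly set" where
  "S_modulus s = Idl\<^bsub>ring_of_type_algebra\<^esub> {x_relation s}"

definition S_ring :: "nat \<Rightarrow> 'a::field poly set ring" where
  "S_ring s = ring_of_type_algebra Quot (S_modulus s)"

definition S_class :: "nat \<Rightarrow> 'a::field poly \<Rightarrow> 'a poly set" where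
  "S_class s f = S_modulus s +>\<^bsub>ring_of_type_algebra\<^esub> f"

definition R_modulus :: "nat \<Rightarrow> nat \<Rightarrow> 'a::field poly poly set" where
  "R_modulus s l =
     Idl\<^bsub>ring_of_type_algebra\<^esub> {[:x_relation s:], Polynomial.monom 1 l - 1}"

definition R_ring :: "nat \<Rightarrow> nat \<Rightarrow> 'a::field poly poly set ring" where
  "R_ring s l = ring_of_type_algebra Quot (R_modulus s l)"

definition R_class :: "nat \<Rightarrow> nat \<Rightarrow> 'a::field poly poly \<Rightarrow> 'a poly poly set" where
  "R_class s l g = R_modulus s l +>\<^bsub>ring_of_type_algebra\<^esub> g"

definition R_y :: "nat \<Rightarrow> nat \<Rightarrow> 'a::field poly poly set" where
  "R_y s l = R_class s l [:0, 1:]"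

text \<open>
  The canonical map from S to R, sending the class of f(x) to the class of f(x).  For a
  coset \<open>c\<close> all classes in the union coincide, because the modulus of S is mapped into
  the modulus of R.
\<close>

definition S_to_R :: "nat \<Rightarrow> nat \<Rightarrow> 'a::field poly set \<Rightarrow> 'a poly poly set" where
  "S_to_R s l c = (\<Union>f\<in>c. R_class s l [:f:])"

text \<open>The element of R given by the sum of \<open>c i\<close> times \<open>y ^ i\<close> over \<open>j \<le> i \<le> l - 1\<close>.\<close>

definition y_expansion ::
  "nat \<Rightarrow> nat \<Rightarrow> nat \<Rightarrow> (nat \<Rightarrow> 'a::field poly set) \<Rightarrow> 'a poly poly set" where
  "y_expansion s l j c =
     (\<Oplus>\<^bsub>R_ring s l\<^esub>i\<in>{j..<l}. S_to_R s l (c i) \<otimes>\<^bsub>R_ring s l\<^esub> (R_y s l [^]\<^bsub>R_ring s l\<^esub> i))"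

definition coeff_ideal ::
  "nat \<Rightarrow> nat \<Rightarrow> 'a::field poly poly set set \<Rightarrow> nat \<Rightarrow> 'a poly set set" where
  "coeff_ideal s l I j =
     {c j | c. (\<forall>i\<in>{j..<l}. c i \<in> carrier (S_ring s)) \<and> y_expansion s l j c \<in> I}"

definition coeff_generator ::
  "nat \<Rightarrow> nat \<Rightarrow> 'a::field poly poly set set \<Rightarrow> nat \<Rightarrow> 'a poly" where
  "coeff_generator s l I j =
     (THE p. lead_coeff p = 1 \<and> p dvd x_relation s \<and>
             coeff_ideal s l I j = Idl\<^bsub>S_ring s\<^esub> {S_class s p})"

end

theory Submission
  imports Defs
begin

text \<open>
  Everything is lifted to polynomials: the preimage \<open>J\<close> of \<open>I\<close> in F[x][y] is an ideal, and
  \<open>I\<^sub>j\<close> is the image of the ideal \<open>A\<^sub>j\<close> of F[x] of all y^j-coefficients of elements of \<open>J\<close> of the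
  form \<open>\<Sum>i=j..<l. f\<^sub>i y^i\<close>.  As \<open>A\<^sub>j\<close> contains x^s - 1, it is generated by a monic divisor of
  x^s - 1.  Subtracting a multiple of \<open>P\<^sub>j\<close> removes the lowest coefficient of such an element, so
  downward induction on \<open>j\<close> reduces every element of \<open>I\<close> to 0 modulo the \<open>P\<^sub>j\<close>.
  Multiplication by y permutes the coefficients cyclically because y^l = 1, hence any coefficient of
  an element of \<open>I\<close> can be moved to position 0 and therefore lies in \<open>I\<^sub>0\<close>.
\<close>

section \<open>Polynomial types as HOL-Algebra rings\<close>

lemma ring_of_type_algebra_sel [simp]:
  "carrier ring_of_type_algebra = UNIV"
  "x \<otimes>\<^bsub>ring_of_type_algebra\<^esub> y = x * y"
  "x \<oplus>\<^bsub>ring_of_type_algebra\<^esub> y = x + y"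
  "\<zero>\<^bsub>ring_of_type_algebra\<^esub> = 0"
  "\<one>\<^bsub>ring_of_type_algebra\<^esub> = 1"
  by (simp_all add: ring_of_type_algebra_def)

lemma ring_of_type_algebra_minus [simp]:
  fixes x :: "'b::comm_ring_1"
  shows "\<ominus>\<^bsub>ring_of_type_algebra\<^esub> x = - x"
    and "x \<ominus>\<^bsub>ring_of_type_algebra\<^esub> y = x - y"
proof -
  interpret T: cring "ring_of_type_algebra :: 'b ring" by (rule cring_from_type_algebra)
  show m: "\<ominus>\<^bsub>ring_of_type_algebra\<^esub> x = - x" for x :: 'b
    using T.minus_equality[of "- x" x] by simp
  show "x \<ominus>\<^bsub>ring_of_type_algebra\<^esub> y = x - y"
    by (simp add: a_minus_def m)
qed

lemma ideal_ring_of_type_algebraD: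
  fixes J :: "'b::comm_ring_1 set"
  assumes "ideal J ring_of_type_algebra"
  shows "0 \<in> J" "a \<in> J \<Longrightarrow> b \<in> J \<Longrightarrow> a + b \<in> J" "a \<in> J \<Longrightarrow> b \<in> J \<Longrightarrow> a - b \<in> J"
    "a \<in> J \<Longrightarrow> c * a \<in> J"
proof -
  interpret ideal J "ring_of_type_algebra :: 'b ring" by fact
  show "0 \<in> J" using additive_subgroup.zero_closed[OF is_additive_subgroup] by simp
  show add: "a + b \<in> J" if "a \<in> J" "b \<in> J" for a b 
    using additive_subgroup.a_closed[OF is_additive_subgroup that] by simp
  show mult: "c * a \<in> J" if "a \<in> J" for a c using I_l_closed[of a c] that by simp
  show "a - b \<in> J" if "a \<in> J" "b \<in> J"
    using add[OF that(1) mult[OF that(2), of "- 1"]] by simp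
qed

lemma coset_eq_iff:
  fixes M :: "'b::comm_ring_1 set"
  assumes "ideal M ring_of_type_algebra"
  shows "M +>\<^bsub>ring_of_type_algebra\<^esub> f = M +>\<^bsub>ring_of_type_algebra\<^esub> g \<longleftrightarrow> f - g \<in> M"
  using ring.quotient_eq_iff_same_a_r_cos[OF ring_from_type_algebra assms, of f g]
  by simp

lemma genideal_singleton_dvd:
  fixes a :: "'b::comm_ring_1"
  shows "Idl\<^bsub>ring_of_type_algebra\<^esub> {a} = {b. a dvd b}"
proof -
  interpret T: cring "ring_of_type_algebra :: 'b ring" by (rule cring_from_type_algebra)
  show ?thesis
    using T.cgenideal_eq_genideal[of a]
    by (auto simp: cgenideal_def dvd_def mult.commute)
qed

section \<open>Class maps from F[x] onto S and from F[x][y] onto R\<close>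

lemma ideal_S_modulus: "ideal (S_modulus s) ring_of_type_algebra"
  unfolding S_modulus_def by (rule ring.genideal_ideal[OF ring_from_type_algebra]) simp

lemma ideal_R_modulus: "ideal (R_modulus s l) ring_of_type_algebra"
  unfolding R_modulus_def by (rule ring.genideal_ideal[OF ring_from_type_algebra]) simp

lemma S_class_hom:
  "ring_hom_cring (ring_of_type_algebra :: 'a::field poly ring) (S_ring s) (S_class s)"
  using ideal.rcos_ring_hom_cring[OF ideal_S_modulus cring_from_type_algebra]
  unfolding S_ring_def S_class_def[abs_def] .

lemma R_class_hom:
  "ring_hom_cring (ring_of_type_algebra :: 'a::field poly poly ring) (R_ring s l) (R_class s l)"
  using ideal.rcos_ring_hom_cring[OF ideal_R_modulus cring_from_type_algebra]
  unfolding R_ring_def R_class_def[abs_def] .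

lemma S_carrier: "carrier (S_ring s) = range (S_class s)"
  unfolding S_ring_def FactRing_def A_RCOSETS_def' S_class_def by auto

lemma R_carrier: "carrier (R_ring s l) = range (R_class s l)"
  unfolding R_ring_def FactRing_def A_RCOSETS_def' R_class_def by auto

lemma S_class_eq_iff: "S_class s f = S_class s g \<longleftrightarrow> x_relation s dvd f - g"
  unfolding S_class_def coset_eq_iff[OF ideal_S_modulus]
  by (simp add: S_modulus_def genideal_singleton_dvd)

lemma R_class_eq_iff: "R_class s l f = R_class s l g \<longleftrightarrow> f - g \<in> R_modulus s l"
  unfolding R_class_def coset_eq_iff[OF ideal_R_modulus] ..

text \<open>These two sufficient conditions take the place of a full description of the
  two-generator ideal.\<close>

lemma R_modulus_memI:
  "[:x_relation s:] dvd g \<Longrightarrow> g \<in> R_modulus s l"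
  "Polynomial.monom 1 l - 1 dvd g \<Longrightarrow> g \<in> R_modulus s l"
proof -
  have "{[:x_relation s:], Polynomial.monom 1 l - 1} \<subseteq> R_modulus s l"
    unfolding R_modulus_def
    by (rule ring.genideal_self[OF ring_from_type_algebra]) simp
  then show "[:x_relation s:] dvd g \<Longrightarrow> g \<in> R_modulus s l"
    "Polynomial.monom 1 l - 1 dvd g \<Longrightarrow> g \<in> R_modulus s l"
    using ideal_ring_of_type_algebraD(4)[OF ideal_R_modulus, of _ s l]
    by (metis dvdE mult.commute insert_subset)+
qed

lemma S_to_R_class: "S_to_R s l (S_class s f) = R_class s l [:f:]"
proof -
  have "R_class s l [:g:] = R_class s l [:f:]" if "g \<in> S_class s f" for g
  proof -
    have "x_relation s dvd g - f"
      using that unfolding S_class_def S_modulus_def a_r_coset_def' genideal_singleton_dvd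
      by auto
    then obtain k where "g - f = x_relation s * k" ..
    then have "[:g:] - [:f:] = [:x_relation s:] * [:k:]" by simp
    then have "[:x_relation s:] dvd [:g:] - [:f:]" ..
    then show ?thesis unfolding R_class_eq_iff by (rule R_modulus_memI)
  qed
  \<comment> \<open>The coset is nonempty, so the union of equal classes is that class and not the
    empty set.\<close>
  moreover have "f \<in> S_class s f"
    unfolding S_class_def S_modulus_def a_r_coset_def' genideal_singleton_dvd
    by (auto intro: exI[of _ 0])
  ultimately show ?thesis unfolding S_to_R_def by blast
qed

section \<open>Expansions in y on the level of polynomials\<close>

definition y_poly :: "nat \<Rightarrow> nat \<Rightarrow> (nat \<Rightarrow> 'b::comm_ring_1) \<Rightarrow> 'b poly" where
  "y_poly l j f = (\<Sum>i=j..<l. Polynomial.monom (f i) i)"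

text \<open>The class map is a ring homomorphism, so it commutes with the powers of y, the products
  and the finite sum. Computations with expansions in R can therefore be done with representatives
  in F[x][y].\<close>

lemma y_expansion_eq:
  assumes "\<And>i. i \<in> {j..<l} \<Longrightarrow> c i = S_class s (f i)"
  shows "y_expansion s l j c = R_class s l (y_poly l j f)"
proof -
  interpret h: ring_hom_cring "ring_of_type_algebra :: 'a poly poly ring" "R_ring s l" "R_class s l"
    by (rule R_class_hom)
  have pow: "x [^]\<^bsub>ring_of_type_algebra\<^esub> (n::nat) = x ^ n" for x :: "'a poly poly" and n
    by (induction n) (simp_all add: mult.commute)
  have summand: "S_to_R s l (c i) \<otimes>\<^bsub>R_ring s l\<^esub> (R_y s l [^]\<^bsub>R_ring s l\<^esub> i)
      = R_class s l (Polynomial.monom (f i) i)" if "i \<in> {j..<l}" for i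
  proof -
    have "R_class s l (Polynomial.monom (f i) i) = R_class s l ([:f i:] * [:0, 1:] ^ i)"
      by (simp add: monom_altdef)
    also have "\<dots> = R_class s l [:f i:] \<otimes>\<^bsub>R_ring s l\<^esub> (R_y s l [^]\<^bsub>R_ring s l\<^esub> i)"
      using h.hom_mult[of "[:f i:]" "[:0, 1:] ^ i"] h.ring.hom_nat_pow[of "[:0, 1:]" i]
      by (simp add: pow R_y_def)
    finally show ?thesis using assms[OF that] by (simp add: S_to_R_class)
  qed
  have fin: "finsum ring_of_type_algebra g A = sum g A"
    if "finite A" for g :: "nat \<Rightarrow> 'a poly poly" and A
    using that by (induction A) auto
  have "y_expansion s l j c = (\<Oplus>\<^bsub>R_ring s l\<^esub>i\<in>{j..<l}. R_class s l (Polynomial.monom (f i) i))"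
    unfolding y_expansion_def
    by (rule h.S.finsum_cong') (auto simp: summand)
  also have "\<dots> = R_class s l (finsum ring_of_type_algebra (\<lambda>i. Polynomial.monom (f i) i) {j..<l})"
    by (subst h.hom_finsum) (auto simp: o_def)
  finally show ?thesis by (simp add: fin y_poly_def)
qed

section \<open>Monic generators of ideals in F[x] and S\<close>

lemma S_genideal_mem_iff:
  assumes "d dvd x_relation s"
  shows "S_class s f \<in> Idl\<^bsub>S_ring s\<^esub> {S_class s d} \<longleftrightarrow> d dvd f"
proof -
  interpret h: ring_hom_cring "ring_of_type_algebra :: 'a poly ring" "S_ring s" "S_class s"
    by (rule S_class_hom)
  have "Idl\<^bsub>S_ring s\<^esub> {S_class s d} = range (\<lambda>a. S_class s (a * d))"
    using h.hom_mult
    by (subst h.S.cgenideal_eq_genideal[symmetric]) (auto simp: cgenideal_def S_carrier)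
  then have "S_class s f \<in> Idl\<^bsub>S_ring s\<^esub> {S_class s d} \<longleftrightarrow> (\<exists>a. x_relation s dvd f - a * d)"
    by (simp add: image_iff S_class_eq_iff)
  \<comment> \<open>Since \<open>d\<close> divides x^s - 1, changing \<open>f\<close> by a multiple
    of x^s - 1 does not affect divisibility by \<open>d\<close>.\<close>
  also have "\<dots> \<longleftrightarrow> d dvd f"
  proof
    assume "\<exists>a. x_relation s dvd f - a * d"
    then obtain a where "x_relation s dvd f - a * d" ..
    then have "d dvd (f - a * d) + a * d"
      by (intro dvd_add dvd_trans[OF assms, of "f - a * d"]) auto
    then show "d dvd f" by simp
  next
    assume "d dvd f"
    then obtain a where "f = d * a" ..
    then have "f - a * d = 0" by (simp add: mult.commute)
    then show "\<exists>a. x_relation s dvd f - a * d" by (metis dvd_0_right)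
  qed
  finally show ?thesis .
qed

text \<open>For positive \<open>s\<close> the constant term -1 cannot cancel x^s. This supplies the
  nonzero element from which a generator of each coefficient ideal is obtained.\<close>

lemma x_relation_nonzero:
  assumes "s \<ge> 1" shows "x_relation s \<noteq> (0 :: 'a::field poly)"
proof -
  have "coeff (x_relation s :: 'a poly) s = 1"
    using assms by (simp add: x_relation_def)
  then show ?thesis by auto
qed

text \<open>Mutual divisibility forces a quotient of degree 0, and comparing leading coefficients
  makes it 1. This gives the uniqueness behind \<open>coeff_generator\<close>.\<close>

lemma monic_dvd_antisym:
  fixes p q :: "'b::idom poly"
  assumes "lead_coeff p = 1" "lead_coeff q = 1" "p dvd q" "q dvd p"
  shows "p = q"
proof -
  obtain k where k: "q = p * k" using assms(3) ..
  have nz: "p \<noteq> 0" "q \<noteq> 0" using assms(1,2) by auto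
  have "degree p = degree q"
    using dvd_imp_degree_le[OF assms(3) nz(2)] dvd_imp_degree_le[OF assms(4) nz(1)] by simp
  then have "degree k = 0" using k nz by (auto simp: degree_mult_eq)
  moreover have "lead_coeff k = 1" using assms(1,2) k by (simp add: lead_coeff_mult)
  ultimately have "k = 1" by (metis degree_0_id one_pCons)
  then show ?thesis using k by simp
qed

text \<open>Division with remainder by a nonzero element \<open>b\<close> of least degree leaves a
  remainder in \<open>A\<close> of smaller degree, hence 0. Scaling \<open>b\<close> by a unit makes
  it monic.\<close>

lemma poly_ideal_monic_generator:
  fixes A :: "'a::field poly set"
  assumes A: "ideal A ring_of_type_algebra" and "a \<in> A" "a \<noteq> 0"
  obtains d where "lead_coeff d = 1" "A = {f. d dvd f}"
proof -
  note I = ideal_ring_of_type_algebraD[OF A]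
  define b where "b = arg_min degree (\<lambda>b. b \<in> A \<and> b \<noteq> 0)"
  have b: "b \<in> A" "b \<noteq> 0" and min: "\<And>c. c \<in> A \<Longrightarrow> c \<noteq> 0 \<Longrightarrow> degree b \<le> degree c"
    using arg_min_nat_lemma[of "\<lambda>b. b \<in> A \<and> b \<noteq> 0" a degree] assms(2,3)
    by (auto simp: b_def)
  have "b dvd f \<longleftrightarrow> f \<in> A" for f
  proof
    assume "f \<in> A"
    have "f mod b = f - (f div b) * b" by (simp add: minus_div_mult_eq_mod)
    then have "f mod b \<in> A" using I(3)[OF \<open>f \<in> A\<close> I(4)[OF b(1)]] by simp
    then show "b dvd f"
      using min[of "f mod b"] degree_mod_less[OF b(2), of f]
      by (metis dvd_eq_mod_eq_0 not_less)
  qed (use I(4)[OF b(1)] in \<open>auto simp: dvd_def mult.commute\<close>)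
  moreover define d where "d = smult (inverse (lead_coeff b)) b"
  ultimately have "A = {f. d dvd f}" "lead_coeff d = 1"
    using b(2) by (auto simp: smult_dvd_iff)
  then show thesis using that by blast
qed

section \<open>Arithmetic of expansions and the cyclic shift modulo y^l - 1\<close>

lemma y_poly_diff_smult:
  "y_poly l j f - Polynomial.smult h (y_poly l j g) = y_poly l j (\<lambda>i. f i - h * g i)"
  by (rule poly_eqI)
     (simp add: y_poly_def coeff_sum sum_distrib_left sum_subtractf[symmetric] if_distrib cong: if_cong)

lemma y_poly_step:
  "j < l \<Longrightarrow> y_poly l j f = Polynomial.monom (f j) j + y_poly l (Suc j) f"
  by (simp add: y_poly_def sum.atLeast_Suc_lessThan)

text \<open>The effect on the coefficients at positions below \<open>l\<close> of multiplication by
  y modulo y^l - 1. Values at larger positions are never read by \<open>y_poly\<close>.\<close>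

definition cyc_shift :: "nat \<Rightarrow> (nat \<Rightarrow> 'b) \<Rightarrow> nat \<Rightarrow> 'b" where
  "cyc_shift l f i = (if i = 0 then f (l - 1) else f (i - 1))"

text \<open>Multiplication by y pushes only the top coefficient out of range. Writing y^l as 1 +
  (y^l - 1) moves it to position 0 and leaves the explicit error term.\<close>

lemma y_poly_cyc_shift:
  assumes "l \<ge> 1"
  shows "[:0, 1:] * y_poly l 0 f =
    y_poly l 0 (cyc_shift l f) + [:f (l - 1):] * (Polynomial.monom 1 l - 1)"
proof -
  obtain m where l: "l = Suc m" using assms by (cases l) auto
  have "[:0, 1:] * y_poly l 0 f = (\<Sum>i<l. Polynomial.monom (f i) (Suc i))"
    by (simp add: y_poly_def sum_distrib_left atLeast0LessThan monom_Suc)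
  also have "\<dots> = (\<Sum>i<m. Polynomial.monom (f i) (Suc i)) + Polynomial.monom (f m) l"
    by (simp add: l)
  also have "(\<Sum>i<m. Polynomial.monom (f i) (Suc i)) = y_poly l 0 (cyc_shift l f) - [:f m:]"
    unfolding y_poly_def l atLeast0LessThan sum.lessThan_Suc_shift
    by (simp add: cyc_shift_def monom_0)
  finally show ?thesis by (simp add: l right_diff_distrib smult_monom)
qed

text \<open>Horner induction: \<open>pCons a g\<close> is y * \<open>g\<close> plus the constant
  \<open>a\<close>. The product is a cyclic shift up to a multiple of y^l - 1, and \<open>a\<close>
  changes position 0 only.\<close>

lemma y_poly_representative:
  assumes "l \<ge> 1"
  shows "\<exists>f. Polynomial.monom 1 l - 1 dvd g - y_poly l 0 f"
proof (induction g)
  case 0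
  show ?case by (rule exI[of _ "\<lambda>_. 0"]) (simp add: y_poly_def)
next
  case (pCons a g)
  then obtain f where "Polynomial.monom 1 l - 1 dvd g - y_poly l 0 f" by blast
  then have "Polynomial.monom 1 l - 1 dvd
      [:0, 1:] * (g - y_poly l 0 f) + [:f (l - 1):] * (Polynomial.monom 1 l - 1)"
    by (intro dvd_add dvd_mult) auto
  moreover have "[:0, 1:] * (g - y_poly l 0 f) + [:f (l - 1):] * (Polynomial.monom 1 l - 1)
      = [:0, 1:] * g - y_poly l 0 (cyc_shift l f)"
    by (simp only: right_diff_distrib y_poly_cyc_shift[OF assms]) simp
  moreover have "pCons a g = [:0, 1:] * g + [:a:]" by simp
  moreover have "y_poly l 0 (\<lambda>i. cyc_shift l f i + (if i = 0 then a else 0))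
      = y_poly l 0 (cyc_shift l f) + [:a:]"
    using assms
    by (simp add: y_poly_def add_monom[symmetric] sum.distrib if_distrib[of "\<lambda>c. Polynomial.monom c _"]
        sum.delta' monom_0 cong: if_cong)
  ultimately have "Polynomial.monom 1 l - 1 dvd
      pCons a g - y_poly l 0 (\<lambda>i. cyc_shift l f i + (if i = 0 then a else 0))"
    by (simp only: add_diff_cancel_right)
  then show ?case by blast
qed

section \<open>The preimage of I and its coefficient ideals in F[x]\<close>

definition lift_ideal :: "nat \<Rightarrow> nat \<Rightarrow> 'a::field poly poly set set \<Rightarrow> 'a poly poly set" where
  "lift_ideal s l I = {g. R_class s l g \<in> I}"

definition lift_coeff_ideal ::
  "nat \<Rightarrow> nat \<Rightarrow> 'a::field poly poly set set \<Rightarrow> nat \<Rightarrow> 'a poly set" where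
  "lift_coeff_ideal s l I j = {f j | f. y_poly l j f \<in> lift_ideal s l I}"

lemma lift_ideal_ideal:
  assumes "ideal I (R_ring s l)"
  shows "ideal (lift_ideal s l I) ring_of_type_algebra"
proof -
  interpret h: ring_hom_cring "ring_of_type_algebra :: 'a poly poly ring" "R_ring s l" "R_class s l"
    by (rule R_class_hom)
  show ?thesis
    using h.ring.ideal_vimage[OF assms] by (simp add: lift_ideal_def)
qed

lemma R_modulus_subset_lift_ideal:
  assumes "ideal I (R_ring s l)" "g \<in> R_modulus s l"
  shows "g \<in> lift_ideal s l I"
proof -
  interpret h: ring_hom_cring "ring_of_type_algebra :: 'a poly poly ring" "R_ring s l" "R_class s l"
    by (rule R_class_hom)
  interpret ideal I "R_ring s l" by fact
  have "R_class s l g = R_class s l 0" using assms(2) by (simp add: R_class_eq_iff)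
  then show ?thesis using additive_subgroup.zero_closed[OF is_additive_subgroup] h.hom_zero by (simp add: lift_ideal_def)
qed

text \<open>Multiplication by constants in y and subtraction act coefficientwise on expansions. All
  closure properties are instances of closure under a - c * b.\<close>

lemma lift_coeff_ideal_ideal:
  assumes "ideal I (R_ring s l)"
  shows "ideal (lift_coeff_ideal s l I j) ring_of_type_algebra"
proof -
  note J = ideal_ring_of_type_algebraD[OF lift_ideal_ideal[OF assms]]
  have z: "0 \<in> lift_coeff_ideal s l I j"
    using J(1) unfolding lift_coeff_ideal_def
    by (auto simp: y_poly_def intro!: exI[of _ "\<lambda>_. 0"])
  have lin: "a - c * b \<in> lift_coeff_ideal s l I j"
    if ab: "a \<in> lift_coeff_ideal s l I j" "b \<in> lift_coeff_ideal s l I j" for a b c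
  proof -
    obtain f g where fg: "a = f j" "b = g j" "y_poly l j f \<in> lift_ideal s l I"
      "y_poly l j g \<in> lift_ideal s l I"
      using ab unfolding lift_coeff_ideal_def by blast
    have "y_poly l j (\<lambda>i. f i - c * g i) \<in> lift_ideal s l I"
      using J(3)[OF fg(3) J(4)[OF fg(4), of "[:c:]"]]
      by (simp add: y_poly_diff_smult)
    then show ?thesis
      unfolding lift_coeff_ideal_def fg(1,2) mem_Collect_eq
      by (intro exI[of _ "\<lambda>i. f i - c * g i"] conjI refl)
  qed
  have mult: "c * b \<in> lift_coeff_ideal s l I j" if "b \<in> lift_coeff_ideal s l I j" for b c
    using lin[OF z that, of "- c"] by simp
  interpret T: cring "ring_of_type_algebra :: 'a poly ring" by (rule cring_from_type_algebra)
  show ?thesis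
  proof (rule idealI)
    show "subgroup (lift_coeff_ideal s l I j) (add_monoid ring_of_type_algebra)"
    proof (rule T.add.subgroupI)
      show "lift_coeff_ideal s l I j \<noteq> {}" using z by blast
      show "\<ominus>\<^bsub>ring_of_type_algebra\<^esub> a \<in> lift_coeff_ideal s l I j"
        if "a \<in> lift_coeff_ideal s l I j" for a
        using mult[OF that, of "- 1"] by simp
      show "a \<oplus>\<^bsub>ring_of_type_algebra\<^esub> b \<in> lift_coeff_ideal s l I j"
        if "a \<in> lift_coeff_ideal s l I j" "b \<in> lift_coeff_ideal s l I j" for a b
        using lin[OF that, of "- 1"] by simp
    qed auto
  qed (use mult in \<open>auto simp: T.ring_axioms mult.commute\<close>)
qed

text \<open>The polynomial (x^s - 1) * y^j is 0 in R, so it lies in the preimage of every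
  ideal.\<close>

lemma x_relation_in_lift_coeff_ideal:
  assumes "ideal I (R_ring s l)" "j < l"
  shows "x_relation s \<in> lift_coeff_ideal s l I j"
proof -
  define f :: "nat \<Rightarrow> 'a poly" where "f i = (if i = j then x_relation s else 0)" for i
  have "y_poly l j f = Polynomial.monom (x_relation s) j"
    using assms(2) by (simp add: y_poly_step) (simp add: y_poly_def f_def)
  also have "\<dots> = Polynomial.monom 1 j * [:x_relation s:]" by (simp add: smult_monom)
  finally have "[:x_relation s:] dvd y_poly l j f" by (metis dvd_triv_right)
  then have "y_poly l j f \<in> lift_ideal s l I"
    using R_modulus_subset_lift_ideal[OF assms(1)] R_modulus_memI(1) by blast
  then show ?thesis unfolding lift_coeff_ideal_def by (auto intro!: exI[of _ f] simp: f_def)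
qed

text \<open>One inclusion chooses polynomial representatives of all coefficients at once, the other
  takes classes; \<open>y_expansion_eq\<close> identifies the two expansions.\<close>

lemma coeff_ideal_eq:
  assumes "j < l"
  shows "coeff_ideal s l I j = S_class s ` lift_coeff_ideal s l I j"
proof (intro equalityI subsetI)
  fix x assume "x \<in> coeff_ideal s l I j"
  then obtain c where c: "x = c j" "\<forall>i\<in>{j..<l}. c i \<in> carrier (S_ring s)"
    "y_expansion s l j c \<in> I" unfolding coeff_ideal_def by blast
  then obtain f where f: "\<And>i. i \<in> {j..<l} \<Longrightarrow> c i = S_class s (f i)"
    unfolding S_carrier image_iff by (auto dest!: bchoice)
  then have "y_poly l j f \<in> lift_ideal s l I"
    using c(3) y_expansion_eq[of j l c s f] f by (simp add: lift_ideal_def)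
  then show "x \<in> S_class s ` lift_coeff_ideal s l I j"
    using c(1) f[of j] assms unfolding lift_coeff_ideal_def by auto
next
  fix x assume "x \<in> S_class s ` lift_coeff_ideal s l I j"
  then obtain f where "x = S_class s (f j)" "y_poly l j f \<in> lift_ideal s l I"
    unfolding lift_coeff_ideal_def by blast
  then show "x \<in> coeff_ideal s l I j"
    unfolding coeff_ideal_def
    using y_expansion_eq[of j l "\<lambda>i. S_class s (f i)" s f]
    by (auto simp: S_carrier lift_ideal_def intro!: exI[of _ "\<lambda>i. S_class s (f i)"])
qed

text \<open>Besides describing the ideal, the proof shows that the definite description in
  \<open>coeff_generator\<close> has exactly one solution, namely the monic generator
  \<open>d\<close> of the lifted coefficient ideal.\<close>

lemma lift_coeff_ideal_eq:
  fixes I :: "'a::field poly poly set set"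
  assumes "s \<ge> 1" "ideal I (R_ring s l)" "j < l"
  shows "lift_coeff_ideal s l I j = {f. coeff_generator s l I j dvd f}"
proof -
  let ?A = "lift_coeff_ideal s l I j"
  have xA: "x_relation s \<in> ?A" by (rule x_relation_in_lift_coeff_ideal[OF assms(2,3)])
  obtain d where d: "lead_coeff d = 1" "?A = {f. d dvd f}"
    by (rule poly_ideal_monic_generator[OF lift_coeff_ideal_ideal[OF assms(2)] xA
          x_relation_nonzero[OF assms(1)]])
  have dx: "d dvd x_relation s" using xA d(2) by blast
  have gen: "coeff_ideal s l I j = Idl\<^bsub>S_ring s\<^esub> {S_class s d}"
  proof -
    interpret h: ring_hom_cring "ring_of_type_algebra :: 'a poly ring" "S_ring s" "S_class s"
      by (rule S_class_hom)
    \<comment> \<open>The membership test \<open>S_genideal_mem_iff\<close> speaks only of classes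
      of polynomials; this inclusion makes it cover the whole generated ideal.\<close>
    have "Idl\<^bsub>S_ring s\<^esub> {S_class s d} \<subseteq> range (S_class s)"
      using ideal.Icarr[OF h.S.genideal_ideal[of "{S_class s d}"]] unfolding S_carrier by blast
    then show ?thesis
      unfolding coeff_ideal_eq[OF assms(3)] d(2)
      using S_genideal_mem_iff[OF dx] by (auto 0 3)
  qed
  have "coeff_generator s l I j = d"
    unfolding coeff_generator_def
  proof (rule the_equality)
    fix q :: "'a poly"
    assume q: "lead_coeff q = 1 \<and> q dvd x_relation s \<and>
      coeff_ideal s l I j = Idl\<^bsub>S_ring s\<^esub> {S_class s q}"
    then have qx: "q dvd x_relation s"
      and same: "Idl\<^bsub>S_ring s\<^esub> {S_class s q} = Idl\<^bsub>S_ring s\<^esub> {S_class s d}"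
      using gen by simp_all
    \<comment> \<open>Both generators divide x^s - 1, so equality of their ideals in S already means
      equality of their multiples in F[x].\<close>
    have eq: "q dvd f \<longleftrightarrow> d dvd f" for f
      unfolding S_genideal_mem_iff[OF dx, symmetric] S_genideal_mem_iff[OF qx, symmetric] same ..
    have "q dvd d" "d dvd q" using eq[of q] eq[of d] by simp_all
    then show "q = d"
      using monic_dvd_antisym q d(1) by blast
  qed (use d dx gen in auto)
  then show ?thesis using d(2) by simp
qed

text \<open>The preimage of \<open>I\<close> is closed under \<open>cyc_shift\<close>, and
  \<open>l - i\<close> shifts carry the coefficient at position \<open>i\<close> around to position
  0.\<close>

lemma coeff_in_lift_coeff_ideal_0:
  assumes "ideal I (R_ring s l)" "y_poly l 0 f \<in> lift_ideal s l I" "i < l"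
  shows "f i \<in> lift_coeff_ideal s l I 0"
proof -
  note J = ideal_ring_of_type_algebraD[OF lift_ideal_ideal[OF assms(1)]]
  have l: "l \<ge> 1" using assms(3) by simp
  have shift: "y_poly l 0 (cyc_shift l f) \<in> lift_ideal s l I"
    if "y_poly l 0 f \<in> lift_ideal s l I" for f
  proof -
    have "Polynomial.monom 1 l - 1 dvd [:f (l - 1):] * (Polynomial.monom 1 l - 1)" by (rule dvd_triv_right)
    then have "[:f (l - 1):] * (Polynomial.monom 1 l - 1) \<in> lift_ideal s l I"
      by (intro R_modulus_subset_lift_ideal[OF assms(1)] R_modulus_memI(2))
    from J(3)[OF J(4)[OF that, of "[:0, 1:]"] this] show ?thesis
      unfolding y_poly_cyc_shift[OF l] by simp
  qed
  have zero: "f 0 \<in> lift_coeff_ideal s l I 0" if "y_poly l 0 f \<in> lift_ideal s l I" for f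
    using that unfolding lift_coeff_ideal_def by blast
  have "i \<le> l - 1" using assms(3) by simp
  then show ?thesis using assms(2)
  \<comment> \<open>The induction runs down from position \<open>l - 1\<close>, where one shift
    wraps around to 0. \<open>f\<close> is arbitrary because each step replaces it by its
    shift.\<close>
  proof (induction arbitrary: f rule: inc_induct)
    case base
    then show ?case using zero[OF shift[OF base]] by (simp add: cyc_shift_def)
  next
    case (step n)
    from step.IH[OF shift[OF step.prems]] show ?case by (simp add: cyc_shift_def)
  qed
qed

section \<open>Generation of I by the P_j and divisibility of their coefficients by p_0^0\<close>

theorem mainTheorem2:
  fixes s l :: nat
    and I :: "'a::{field, finite} poly poly set set"
    and p :: "nat \<Rightarrow> nat \<Rightarrow> 'a poly set"
    and P :: "nat \<Rightarrow> 'a poly poly set"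
  assumes "s \<ge> 1" and "l \<ge> 1"
    and "ideal I (R_ring s l)"
    and "\<And>j i. j < l \<Longrightarrow> i \<in> {j..<l} \<Longrightarrow> p j i \<in> carrier (S_ring s)"
    and "\<And>j. j < l \<Longrightarrow> p j j = S_class s (coeff_generator s l I j)"
    and "\<And>j. j < l \<Longrightarrow> P j = y_expansion s l j (p j)"
    and "\<And>j. j < l \<Longrightarrow> P j \<in> I"
  shows "I = Idl\<^bsub>R_ring s l\<^esub> (P ` {..<l}) \<and>
    (\<forall>j<l. \<exists>t :: nat \<Rightarrow> 'a poly set. (\<forall>i\<in>{j..<l}. t i \<in> carrier (S_ring s)) \<and>
       P j = y_expansion s l j
               (\<lambda>i. S_class s (coeff_generator s l I 0) \<otimes>\<^bsub>S_ring s\<^esub> t i))"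
proof -
  interpret h: ring_hom_cring "ring_of_type_algebra :: 'a poly poly ring" "R_ring s l" "R_class s l"
    by (rule R_class_hom)
  interpret hS: ring_hom_cring "ring_of_type_algebra :: 'a poly ring" "S_ring s" "S_class s"
    by (rule S_class_hom)
  interpret I: ideal I "R_ring s l" by fact
  note J = ideal_ring_of_type_algebraD[OF lift_ideal_ideal[OF assms(3)]]
  note gen = lift_coeff_ideal_eq[OF assms(1,3)]
  define d where "d = coeff_generator s l I"
  \<comment> \<open>The representative at position \<open>j\<close> is fixed to be
    \<open>d j\<close> itself, not merely congruent to it, so that leading terms cancel exactly in
    F[x].\<close>
  have "\<exists>q. q j = d j \<and> (\<forall>i\<in>{j..<l}. p j i = S_class s (q i))" if "j < l" for j
  proof -
    have "\<forall>i\<in>{j..<l}. \<exists>f. p j i = S_class s f"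
      using assms(4)[OF that] unfolding S_carrier by blast
    then obtain q where "\<forall>i\<in>{j..<l}. p j i = S_class s (q i)" by (auto dest!: bchoice)
    then show ?thesis
      using assms(5)[OF that] by (intro exI[of _ "q(j := d j)"]) (auto simp: d_def)
  qed
  then obtain q where qj: "\<And>j. j < l \<Longrightarrow> q j j = d j"
    and q: "\<And>j i. j < l \<Longrightarrow> i \<in> {j..<l} \<Longrightarrow> p j i = S_class s (q j i)"
    by metis
  have P: "P j = R_class s l (y_poly l j (q j))" if "j < l" for j
    unfolding assms(6)[OF that] by (rule y_expansion_eq) (rule q[OF that])
  have PJ: "y_poly l j (q j) \<in> lift_ideal s l I" if "j < l" for j
    using assms(7)[OF that] P[OF that] by (simp add: lift_ideal_def)

  let ?K = "Idl\<^bsub>R_ring s l\<^esub> (P ` {..<l})"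
  have Pcarr: "P ` {..<l} \<subseteq> carrier (R_ring s l)" using assms(7) I.Icarr by blast
  have K: "ideal ?K (R_ring s l)" using Pcarr by (rule h.S.genideal_ideal)
  \<comment> \<open>The generated ideal is lifted as well, so that the reduction of \<open>I\<close>
    takes place inside F[x][y].\<close>
  note JK = ideal_ring_of_type_algebraD[OF lift_ideal_ideal[OF K]]
  have PK: "y_poly l j (q j) \<in> lift_ideal s l ?K" if "j < l" for j
    using h.S.genideal_self[OF Pcarr] P[OF that] that by (auto simp: lift_ideal_def)
  \<comment> \<open>Downward induction on \<open>j\<close>, starting at \<open>l\<close>, where the
    expansion is an empty sum.\<close>
  have yK: "y_poly l j f \<in> lift_ideal s l ?K"
    if "j \<le> l" "y_poly l j f \<in> lift_ideal s l I" for j f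
    using that
  proof (induction arbitrary: f rule: inc_induct)
    case base
    then show ?case using JK(1) by (simp add: y_poly_def)
  next
    case (step n)
    have "f n \<in> lift_coeff_ideal s l I n"
      using step.prems unfolding lift_coeff_ideal_def by blast
    then obtain c where c: "f n = d n * c" unfolding gen[OF step.hyps(2)] d_def by blast
    \<comment> \<open>The coefficient of y^n in \<open>?r\<close> is
      \<open>f n - c * d n = 0\<close>, so the remaining expansion starts at
      \<open>Suc n\<close>.\<close>
    let ?r = "\<lambda>i. f i - c * q n i"
    have r: "y_poly l n f - [:c:] * y_poly l n (q n) = y_poly l (Suc n) ?r"
      using qj[OF step.hyps(2)] c y_poly_step[OF step.hyps(2), of ?r]
      by (simp add: y_poly_diff_smult)
    have "y_poly l (Suc n) ?r \<in> lift_ideal s l I"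
      using J(3)[OF step.prems J(4)[OF PJ[OF step.hyps(2)]], of "[:c:]"] unfolding r .
    from JK(2)[OF step.IH[OF this] JK(4)[OF PK[OF step.hyps(2)], of "[:c:]"]]
    show ?case unfolding r[symmetric] by simp
  qed
  have "I \<subseteq> ?K"
  proof
    fix x assume "x \<in> I"
    then obtain g where g: "x = R_class s l g" using I.Icarr R_carrier by blast
    \<comment> \<open>Reduction modulo y^l - 1 gives a representative of y-degree below
      \<open>l\<close>, to which \<open>yK\<close> with \<open>j = 0\<close> applies.\<close>
    obtain f where "Polynomial.monom 1 l - 1 dvd g - y_poly l 0 f"
      using y_poly_representative[OF assms(2)] by blast
    then have x: "x = R_class s l (y_poly l 0 f)"
      unfolding g R_class_eq_iff by (rule R_modulus_memI(2))
    then show "x \<in> ?K" using yK[of 0 f] \<open>x \<in> I\<close> by (simp add: lift_ideal_def)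
  qed
  moreover have "?K \<subseteq> I"
    using assms(7) by (intro h.S.genideal_minimal[OF assms(3)]) auto
  moreover have "\<exists>t. (\<forall>i\<in>{j..<l}. t i \<in> carrier (S_ring s)) \<and>
       P j = y_expansion s l j (\<lambda>i. S_class s (d 0) \<otimes>\<^bsub>S_ring s\<^esub> t i)" if "j < l" for j
  proof -
    \<comment> \<open>Padding with zeros below \<open>j\<close> turns the representative of
      \<open>P j\<close> into an expansion from position 0, as the shift argument requires.\<close>
    define f where "f i = (if i < j then 0 else q j i)" for i
    have "y_poly l 0 f = y_poly l j (q j)"
      unfolding y_poly_def f_def using that
      by (intro sum.mono_neutral_cong_right) auto
    then have "y_poly l 0 f \<in> lift_ideal s l I" using PJ[OF that] by simp
    then have "d 0 dvd f i" if "i < l" for i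
      using coeff_in_lift_coeff_ideal_0[OF assms(3) _ that] gen[of 0] assms(2)
      by (auto simp: d_def)
    then have "\<forall>i\<in>{j..<l}. \<exists>u. q j i = d 0 * u"
      unfolding f_def dvd_def by (metis atLeastLessThan_iff not_less)
    \<comment> \<open>The quotients are chosen in F[x]; their classes serve as the elements
      \<open>t i\<close>.\<close>
    then obtain u where u: "\<forall>i\<in>{j..<l}. q j i = d 0 * u i" by (auto dest!: bchoice)
    have "y_expansion s l j (\<lambda>i. S_class s (d 0) \<otimes>\<^bsub>S_ring s\<^esub> S_class s (u i))
        = R_class s l (y_poly l j (q j))"
      by (rule y_expansion_eq) (use u hS.hom_mult[of "d 0"] in auto)
    then show ?thesis
      unfolding P[OF that] by (intro exI[of _ "\<lambda>i. S_class s (u i)"]) (auto simp: S_carrier)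
  qed
  ultimately show ?thesis unfolding d_def by blast
qed

end
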